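(* Let $\beta$ be a one-dimensional (real-valued) Brownian motion. Let $h$ be the geometric Brownian motion $$h(t)=e^{-2\beta(t)-2t}\qquad\text{on }[0,\infty),$$ extended by $h(t)=t+1$ for $-1\le t<0$ and $h(t)=0$ for $t<-1$ to the real line. Then, for every $p\in(2,\infty)$, $h\in V^p_0$ $\mathbb P$-a.s.
   Context: Let $\mathcal P=\{(t_j)_{j=1}^N:N\in\mathbb N,\ t_j\in\mathbb R,\ t_j<t_{j+1}\}$ be the set of finite partitions. For $1\le p<\infty$ and $v:\mathbb R\to\mathbb C$ set $\|v\|_{V^p}=\sup_{(t_j)\in\mathcal P}\big(|v(t_N)|^p+\sum_{j=1}^{N-1}|v(t_{j+1})-v(t_j)|^p\big)^{1/p}$, and $V^p_0=\{v:\mathbb R\to\mathbb C\ |\ v\text{ right-continuous},\ \lim_{t\to-\infty}v(t)=0,\ \|v\|_{V^p}<\infty\}$. *)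

theory Defs
  imports "HOL-Probability.Probability"
begin

text \<open>
  Standard one-dimensional Brownian motion, indexed by times \<open>t \<ge> 0\<close>; the values of \<open>B\<close> at
  negative times are irrelevant. Only almost every path is required to start at 0 and to be
  continuous. The second argument of \<^const>\<open>normal_density\<close> is the standard deviation.
\<close>

locale brownian_motion = prob_space M for M :: "'a measure" +
  fixes B :: "real \<Rightarrow> 'a \<Rightarrow> real"
  assumes random_variable_B: "\<And>t. 0 \<le> t \<Longrightarrow> random_variable borel (B t)"
    and start_zero: "AE \<omega> in M. B 0 \<omega> = 0"
    and indep_increments:
      "\<And>(n::nat) (t :: nat \<Rightarrow> real). 0 \<le> t 0 \<Longrightarrow> (\<And>i. i < n \<Longrightarrow> t i < t (Suc i)) \<Longrightarrow>
         indep_vars (\<lambda>_. borel) (\<lambda>i \<omega>. B (t (Suc i)) \<omega> - B (t i) \<omega>) {..<n}"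
    and normal_increments:
      "\<And>s t. 0 \<le> s \<Longrightarrow> s < t \<Longrightarrow>
         distributed M lborel (\<lambda>\<omega>. B t \<omega> - B s \<omega>) (\<lambda>x. ennreal (normal_density 0 (sqrt (t - s)) x))"
    and continuous_paths: "AE \<omega> in M. continuous_on {0..} (\<lambda>t. B t \<omega>)"

text \<open>
  A partition \<open>(t\<^sub>j)\<close>, \<open>1 \<le> j \<le> N\<close>, is a list of length \<open>N \<ge> 1\<close>; the norm involves \<open>t\<^sub>N\<close>, so
  the empty list is excluded.
\<close>

definition partitions :: "real list set" where
  "partitions = {ts. ts \<noteq> [] \<and> sorted_wrt (<) ts}"

text \<open>The norm takes the value \<open>\<infinity>\<close> if the supremum is infinite.\<close>

definition Vp_norm :: "real \<Rightarrow> (real \<Rightarrow> complex) \<Rightarrow> ennreal" where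
  "Vp_norm p v = (SUP ts\<in>partitions.
     ennreal ((norm (v (last ts)) powr p +
       (\<Sum>j<length ts - 1. norm (v (ts ! Suc j) - v (ts ! j)) powr p)) powr (1 / p)))"

definition V0 :: "real \<Rightarrow> (real \<Rightarrow> complex) set" where
  "V0 p = {v. (\<forall>t. continuous (at_right t) v) \<and> (v \<longlongrightarrow> 0) at_bot \<and> Vp_norm p v < \<infinity>}"

definition geometric_extension :: "(real \<Rightarrow> real) \<Rightarrow> real \<Rightarrow> real" where
  "geometric_extension b t =
     (if t \<ge> 0 then exp (- 2 * b t - 2 * t) else if t \<ge> - 1 then t + 1 else 0)"

end

theory Submission
  imports Defs
begin

text \<open>
  Finite \<open>p\<close>-variation on the whole line is obtained by comparison with a bounded monotone
  function. If \<open>\<bar>h t - h s\<bar>\<^sup>p \<le> \<phi> t - \<phi> s\<close> for all \<open>s < t\<close>, where \<open>\<phi>\<close> is bounded, then the sum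
  over any partition telescopes to at most the oscillation of \<open>\<phi>\<close>; and if \<open>\<phi>\<close> is continuous, so
  is \<open>h\<close> (\<open>in_V0_if_increments_dominated\<close>). On \<open>[0, \<infinity>)\<close> one takes \<open>\<phi> t = - L * exp (- t)\<close>; on
  \<open>(-\<infinity>, 0]\<close> the function \<open>h\<close> is itself monotone with values in \<open>[0, 1]\<close>, and can be used as \<open>\<phi>\<close> because
  \<open>x\<^sup>p \<le> x\<close> there.

  The comparison on \<open>[0, \<infinity>)\<close> needs two properties of a Brownian path \<open>b\<close>, for some \<open>\<gamma> < 1\<close>:
  an increment bound \<open>\<bar>b t - b s\<bar> \<le> K (1 + t)\<^sup>\<gamma> (t - s)\<^bsup>1/p\<^esup>\<close> for \<open>s \<le> t \<le> s + 1\<close>, and the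
  growth bound \<open>\<bar>b n\<bar> \<le> K (1 + n)\<^sup>\<gamma>\<close> at the integers. Together they make \<open>b\<close> sublinear, so
  the drift wins and \<open>h t \<le> H exp (- t)\<close>; for close times \<open>\<bar>h t - h s\<bar>\<^sup>p\<close> is then at most a constant
  times \<open>exp (- s) (t - s)\<close>, hence times \<open>exp (- s) - exp (- t)\<close>, and for distant times the decay of
  \<open>h\<close> alone suffices (\<open>geometric_increments_dominated\<close>).

  Both bounds come from Gaussian moments. The increment over an interval of length \<open>\<delta>\<close> has
  \<open>2q\<close>-th moment proportional to \<open>\<delta>\<^sup>q\<close>. Dividing countably many increments by suitable weights
  makes the sum of their moments finite, and then almost surely all the weighted increments
  are bounded by one random constant (\<open>AE_bounded_if_moments_summable\<close>). For the dyadic intervals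
  of every generation this gives a Hoelder condition on the dyadic grid, with any exponent below
  \<open>1/2\<close>; that \<open>1/p\<close> is such an exponent is exactly the hypothesis \<open>p > 2\<close>. Chaining along
  dyadic approximations and path continuity extend it to all times
  (\<open>holder_from_dyadic_increments\<close>).
\<close>

section \<open>A criterion for finite variation\<close>

text \<open>
  The partition sum telescopes, and letting \<open>s \<rightarrow> -\<infinity>\<close> in the hypothesis bounds \<open>v\<close>
  itself, which takes care of the term at the last partition point. Right-continuity is inherited from \<open>\<phi>\<close>.
\<close>

lemma in_V0_if_increments_dominated:
  fixes v :: "real \<Rightarrow> complex" and \<phi> :: "real \<Rightarrow> real"
  assumes p: "1 \<le> p"
    and cont: "continuous_on UNIV \<phi>"
    and bounds: "\<And>t. a \<le> \<phi> t" "\<And>t. \<phi> t \<le> b"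
    and dom: "\<And>s t. s < t \<Longrightarrow> norm (v t - v s) powr p \<le> \<phi> t - \<phi> s"
    and lim: "(v \<longlongrightarrow> 0) at_bot"
  shows "v \<in> V0 p"
proof -
  have bound: "norm (v t) powr p \<le> b - a" for t
  proof -
    have "norm (v t - 0) powr p \<le> b - a"
    proof (rule tendsto_upperbound)
      show "((\<lambda>s. norm (v t - v s) powr p) \<longlongrightarrow> norm (v t - 0) powr p) at_bot"
        using p lim by (intro tendsto_intros) auto
      show "\<forall>\<^sub>F s in at_bot. norm (v t - v s) powr p \<le> b - a"
        using eventually_gt_at_bot[of t]
      proof eventually_elim
        case (elim s)
        show ?case using dom[OF elim] bounds(1)[of s] bounds(2)[of t] by linarith
      qed
    qed simp
    then show ?thesis by simp
  qed
  have "continuous (at_right t) v" for t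
  proof -
    have "(\<phi> \<longlongrightarrow> \<phi> t) (at_right t)"
      using cont by (auto simp: continuous_on_eq_continuous_at isCont_def intro: filterlim_at_split[THEN iffD1, THEN conjunct2])
    then have "((\<lambda>u. \<phi> u - \<phi> t) \<longlongrightarrow> \<phi> t - \<phi> t) (at_right t)"
      by (intro tendsto_intros)
    then have lim0: "((\<lambda>u. \<phi> u - \<phi> t) \<longlongrightarrow> 0) (at_right t)" by simp
    have "((\<lambda>u. norm (v u - v t) powr p) \<longlongrightarrow> 0) (at_right t)"
    proof (rule tendsto_sandwich[OF _ _ tendsto_const lim0])
      show "\<forall>\<^sub>F u in at_right t. norm (v u - v t) powr p \<le> \<phi> u - \<phi> t"
        unfolding eventually_at_filter by (intro always_eventually) (auto intro: dom)
    qed simp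
    then have "((\<lambda>u. (norm (v u - v t) powr p) powr (1/p)) \<longlongrightarrow> 0 powr (1/p)) (at_right t)"
      using p by (intro tendsto_powr') auto
    then have "((\<lambda>u. norm (v u - v t)) \<longlongrightarrow> 0) (at_right t)"
      using p by (simp add: powr_powr)
    then have "(v \<longlongrightarrow> v t) (at_right t)"
      by (simp add: tendsto_norm_zero_iff LIM_zero_iff)
    then show ?thesis by (simp add: continuous_within)
  qed
  moreover have "Vp_norm p v < \<infinity>"
  proof -
    have "Vp_norm p v \<le> ennreal ((2 * (b - a)) powr (1/p))"
      unfolding Vp_norm_def
    proof (rule SUP_least)
      fix ts assume ts: "ts \<in> partitions"
      have "(\<Sum>j<length ts - 1. norm (v (ts ! Suc j) - v (ts ! j)) powr p)
          \<le> (\<Sum>j<length ts - 1. \<phi> (ts ! Suc j) - \<phi> (ts ! j))"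
        using ts by (intro sum_mono dom)
          (auto simp: partitions_def sorted_wrt_nth_less)
      also have "\<dots> = \<phi> (ts ! (length ts - 1)) - \<phi> (ts ! 0)"
        by (rule sum_lessThan_telescope)
      also have "\<dots> \<le> b - a"
        using bounds(1)[of "ts ! 0"] bounds(2)[of "ts ! (length ts - 1)"] by linarith
      finally have "norm (v (last ts)) powr p +
          (\<Sum>j<length ts - 1. norm (v (ts ! Suc j) - v (ts ! j)) powr p) \<le> 2 * (b - a)"
        using add_mono[OF bound[of "last ts"]] by (simp only: mult_2)
      then show "ennreal ((norm (v (last ts)) powr p +
          (\<Sum>j<length ts - 1. norm (v (ts ! Suc j) - v (ts ! j)) powr p)) powr (1 / p))
          \<le> ennreal ((2 * (b - a)) powr (1/p))"
        using p by (intro ennreal_leI powr_mono2 add_nonneg_nonneg sum_nonneg) auto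
    qed
    then show ?thesis
      using ennreal_less_top le_less_trans by fastforce
  qed
  ultimately show ?thesis using lim by (simp add: V0_def)
qed

section \<open>Chaining along dyadic approximations\<close>

text \<open>
  The dyadic approximations of \<open>t\<close> from below increase to \<open>t\<close>, and two consecutive ones are either
  equal or neighbours in the finer grid. Hence the difference is a telescoping sum dominated
  by the geometric series of \<open>r\<close>. Every interval involved lies to the left of \<open>t\<close>, so one weight
  \<open>(1 + t) powr \<gamma>\<close> serves for the whole sum.
\<close>

lemma chaining_from_dyadic_point:
  fixes f :: "real \<Rightarrow> real"
  assumes cont: "continuous_on {0..} f"
    and r: "0 < r" "r < 1" and C: "0 \<le> C" and \<gamma>: "0 \<le> \<gamma>"
    and dyadic: "\<And>k j. \<bar>f (real (Suc j) / 2 ^ k) - f (real j / 2 ^ k)\<bar>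
      \<le> C * r ^ k * (1 + real j / 2 ^ k) powr \<gamma>"
    and t: "0 \<le> t"
  shows "\<bar>f t - f (real (nat \<lfloor>t * 2 ^ k\<rfloor>) / 2 ^ k)\<bar> \<le> C * (1 + t) powr \<gamma> * r ^ k / (1 - r)"
proof -
  define J where "J i = nat \<lfloor>t * 2 ^ i\<rfloor>" for i
  define d where "d i = real (J i) / 2 ^ i" for i
  have J: "real (J i) \<le> t * 2 ^ i" "t * 2 ^ i < real (J i) + 1" for i
    using t unfolding J_def by (auto simp: of_nat_nat) 
  have d: "0 \<le> d i" "d i \<le> t" "t < d i + 1 / 2 ^ i" for i
    using J[of i] by (auto simp: d_def field_simps)
  \<comment> \<open>Halving the mesh either keeps the grid point below \<open>t\<close> or moves it one fine step to the right.\<close>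
  have step: "\<bar>f (d (Suc i)) - f (d i)\<bar> \<le> C * (1 + t) powr \<gamma> * r ^ Suc i" for i
  proof -
    have "real (2 * J i) < real (J (Suc i)) + 1" "real (J (Suc i)) < real (2 * J i + 2)"
      using J[of i] J[of "Suc i"] by auto
    then have "2 * J i < J (Suc i) + 1" "J (Suc i) < 2 * J i + 2"
      by linarith+
    then consider "J (Suc i) = 2 * J i" | "J (Suc i) = Suc (2 * J i)" by linarith
    then show ?thesis
    proof cases
      case 1
      then have "d (Suc i) = d i" by (simp add: d_def)
      then show ?thesis using C r by simp
    next
      case 2
      have "d i = real (2 * J i) / 2 ^ Suc i" by (simp add: d_def)
      moreover have "d (Suc i) = real (Suc (2 * J i)) / 2 ^ Suc i" by (simp only: d_def 2)
      ultimately have "\<bar>f (d (Suc i)) - f (d i)\<bar>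
          \<le> C * r ^ Suc i * (1 + d i) powr \<gamma>"
        using dyadic[of "2 * J i" "Suc i"] by metis
      also have "\<dots> \<le> C * r ^ Suc i * (1 + t) powr \<gamma>"
        using C r \<gamma> d[of i] by (intro mult_left_mono powr_mono2) auto
      finally show ?thesis by (simp add: mult_ac)
    qed
  qed
  have sum: "\<bar>f (d (k + n)) - f (d k)\<bar> \<le> C * (1 + t) powr \<gamma> * r ^ k * ((1 - r ^ n) / (1 - r))" for n
  proof (induction n)
    case (Suc n)
    have "\<bar>f (d (k + Suc n)) - f (d k)\<bar>
        \<le> \<bar>f (d (Suc (k + n))) - f (d (k + n))\<bar> + \<bar>f (d (k + n)) - f (d k)\<bar>"
      by simp
    also have "\<dots> \<le> C * (1 + t) powr \<gamma> * r ^ Suc (k + n)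
        + C * (1 + t) powr \<gamma> * r ^ k * ((1 - r ^ n) / (1 - r))"
      by (intro add_mono step Suc.IH)
    also have "\<dots> \<le> C * (1 + t) powr \<gamma> * r ^ (k + n)
        + C * (1 + t) powr \<gamma> * r ^ k * ((1 - r ^ n) / (1 - r))"
      using C r by (intro add_right_mono mult_left_mono power_decreasing) auto
    also have "\<dots> = C * (1 + t) powr \<gamma> * r ^ k * (r ^ n + (1 - r ^ n) / (1 - r))"
      by (simp add: power_add algebra_simps)
    also have "r ^ n + (1 - r ^ n) / (1 - r) = (1 - r ^ Suc n) / (1 - r)"
      using r by (simp add: field_simps)
    finally show ?case .
  qed simp
  have "d \<longlonglongrightarrow> t"
  proof (rule tendsto_sandwich)
    show "(\<lambda>i. t - (1/2) ^ i) \<longlonglongrightarrow> t"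
      by (auto intro!: tendsto_eq_intros LIMSEQ_realpow_zero)
    show "\<forall>\<^sub>F i in sequentially. t - (1/2) ^ i \<le> d i"
      using d(3) by (intro always_eventually allI) (simp add: power_one_over, smt (verit))
  qed (use d in auto)
  then have "(\<lambda>n. f (d n)) \<longlonglongrightarrow> f t"
    by (intro continuous_on_tendsto_compose[OF cont]) (use t d in auto)
  then have "(\<lambda>n. f (d (k + n))) \<longlonglongrightarrow> f t"
    using LIMSEQ_ignore_initial_segment[of "\<lambda>n. f (d n)" "f t" k] by (simp add: add.commute)
  then have "(\<lambda>n. \<bar>f (d (k + n)) - f (d k)\<bar>) \<longlonglongrightarrow> \<bar>f t - f (d k)\<bar>"
    by (intro tendsto_intros)
  moreover have "\<bar>f (d (k + n)) - f (d k)\<bar> \<le> C * (1 + t) powr \<gamma> * r ^ k / (1 - r)" for n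
  proof -
    have "C * (1 + t) powr \<gamma> * r ^ k * ((1 - r ^ n) / (1 - r))
        \<le> C * (1 + t) powr \<gamma> * r ^ k * (1 / (1 - r))"
      using C r by (intro mult_left_mono divide_right_mono) auto
    with sum[of n] show ?thesis by simp
  qed
  ultimately have "\<bar>f t - f (d k)\<bar> \<le> C * (1 + t) powr \<gamma> * r ^ k / (1 - r)"
    by (intro LIMSEQ_le_const2) auto
  then show ?thesis by (simp add: d_def J_def)
qed

text \<open>
  For times at distance about \<open>2\<^bsup>-k\<^esup>\<close>, pass through the grid points of generation \<open>k\<close> below them:
  these are equal or adjacent, and \<open>chaining_from_dyadic_point\<close> controls the two remaining pieces.
  The weight is polynomial in time because the local Hoelder constants of a Brownian path are
  unbounded on the half-line.
\<close>

lemma holder_from_dyadic_increments: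
  fixes f :: "real \<Rightarrow> real"
  assumes cont: "continuous_on {0..} f"
    and \<alpha>: "0 < \<alpha>" and C: "0 \<le> C" and \<gamma>: "0 \<le> \<gamma>"
    and dyadic: "\<And>k j. \<bar>f (real (Suc j) / 2 ^ k) - f (real j / 2 ^ k)\<bar>
      \<le> C * (2 powr - \<alpha>) ^ k * (1 + real j / 2 ^ k) powr \<gamma>"
  obtains K where "0 \<le> K"
    and "\<And>s t. 0 \<le> s \<Longrightarrow> s \<le> t \<Longrightarrow> t \<le> s + 1 \<Longrightarrow>
      \<bar>f t - f s\<bar> \<le> K * (1 + t) powr \<gamma> * (t - s) powr \<alpha>"
proof
  define r :: real where "r = 2 powr - \<alpha>"
  have r: "0 < r" "r < 1" using \<alpha> by (auto simp: r_def powr_less_one)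
  define K where "K = C * (2 / (1 - r) + 1) * 2 powr \<alpha>"
  show "0 \<le> K" using C r by (simp add: K_def)
  fix s t :: real
  assume st: "0 \<le> s" "s \<le> t" "t \<le> s + 1"
  show "\<bar>f t - f s\<bar> \<le> K * (1 + t) powr \<gamma> * (t - s) powr \<alpha>"
  proof (cases "s = t")
    case False
    with st have pos: "0 < t - s" by simp
    \<comment> \<open>The generation \<open>k\<close> is fixed by \<open>(1/2) ^ Suc k < t - s \<le> (1/2) ^ k\<close>.\<close>
    define m where "m = (LEAST n. (1/2::real) ^ n < t - s)"
    have ex: "\<exists>n. (1/2::real) ^ n < t - s" using pos by (intro real_arch_pow_inv) auto
    then have m: "(1/2) ^ m < t - s" unfolding m_def by (rule LeastI_ex)
    with st have "m \<noteq> 0" by (intro notI) simp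
    then obtain k where k: "m = Suc k" using not0_implies_Suc by blast
    have k2: "t - s \<le> (1/2) ^ k"
      using not_less_Least[of k "\<lambda>n. (1/2::real) ^ n < t - s"] k m_def by simp
    have k1: "(1/2) ^ Suc k < t - s" using m k by simp
    define a where "a = nat \<lfloor>s * 2 ^ k\<rfloor>"
    define b where "b = nat \<lfloor>t * 2 ^ k\<rfloor>"
    have a: "real a \<le> s * 2 ^ k" "s * 2 ^ k < real a + 1"
      using st unfolding a_def by (auto simp: of_nat_nat)
    have b: "real b \<le> t * 2 ^ k" "t * 2 ^ k < real b + 1"
      using st unfolding b_def by (auto simp: of_nat_nat)
    have "t * 2 ^ k \<le> s * 2 ^ k + 1"
      using k2 by (simp add: field_simps power_one_over)
    moreover have "s * 2 ^ k \<le> t * 2 ^ k" using st by simp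
    ultimately have "real a < real b + 1" "real b < real a + 2" using a b by linarith+
    then consider "b = a" | "b = Suc a" by linarith
    then have mid: "\<bar>f (real b / 2 ^ k) - f (real a / 2 ^ k)\<bar> \<le> C * (1 + t) powr \<gamma> * r ^ k"
    proof cases
      case 1
      then show ?thesis using C r by simp
    next
      case 2
      have "real a / 2 ^ k \<le> t" using a(1) \<open>s * 2 ^ k \<le> t * 2 ^ k\<close>
        by (simp only: pos_divide_le_eq zero_less_power zero_less_numeral)
      then have "C * r ^ k * (1 + real a / 2 ^ k) powr \<gamma> \<le> C * r ^ k * (1 + t) powr \<gamma>"
        using C r \<gamma> by (intro mult_left_mono powr_mono2) auto
      with dyadic[where j=a and k=k] 2 show ?thesis by (simp add: r_def mult_ac)
    qed
    note chain = chaining_from_dyadic_point[OF cont r C \<gamma> dyadic[folded r_def]]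
    have "\<bar>f t - f (real b / 2 ^ k)\<bar> \<le> C * (1 + t) powr \<gamma> * r ^ k / (1 - r)"
      unfolding b_def using st by (intro chain) auto
    moreover have "\<bar>f s - f (real a / 2 ^ k)\<bar> \<le> C * (1 + t) powr \<gamma> * r ^ k / (1 - r)"
    proof -
      have "C * (1 + s) powr \<gamma> * r ^ k / (1 - r) \<le> C * (1 + t) powr \<gamma> * r ^ k / (1 - r)"
        using C r \<gamma> st by (intro divide_right_mono mult_right_mono mult_left_mono powr_mono2) auto
      then show ?thesis using chain[of s k] st unfolding a_def by simp
    qed
    ultimately have "\<bar>f t - f s\<bar>
        \<le> 2 * (C * (1 + t) powr \<gamma> * r ^ k / (1 - r)) + C * (1 + t) powr \<gamma> * r ^ k"
      using mid by linarith
    also have "\<dots> = C * (2 / (1 - r) + 1) * (1 + t) powr \<gamma> * r ^ k"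
      by (simp add: algebra_simps)
    also have "\<dots> \<le> C * (2 / (1 - r) + 1) * (1 + t) powr \<gamma> * (2 powr \<alpha> * (t - s) powr \<alpha>)"
    proof (rule mult_left_mono)
      have "r ^ k = (2 * (1/2) ^ Suc k) powr \<alpha>"
        by (simp add: r_def powr_minus power_inverse powr_divide powr_powr powr_realpow[symmetric]
            power_one_over inverse_eq_divide powr_power mult.commute)
      also have "\<dots> \<le> (2 * (t - s)) powr \<alpha>"
        using k1 \<alpha> by (intro powr_mono2) auto
      also have "\<dots> = 2 powr \<alpha> * (t - s) powr \<alpha>"
        by (rule powr_mult)
      finally show "r ^ k \<le> 2 powr \<alpha> * (t - s) powr \<alpha>" .
    qed (use C r in auto)
    also have "\<dots> = K * (1 + t) powr \<gamma> * (t - s) powr \<alpha>"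
      by (simp add: K_def mult_ac)
    finally show ?thesis .
  qed simp
qed

section \<open>Geometric functions of a sublinear Hoelder path\<close>

text \<open>
  The threshold \<open>C powr (1 / (1 - \<gamma>))\<close> is the point where \<open>C * x powr \<gamma> = x\<close>: beyond it \<open>x\<close>
  dominates, and below it the left side is at most its value there.
\<close>

lemma sublinear_powr_bound:
  fixes C \<gamma> x :: real
  assumes "0 \<le> C" "0 \<le> \<gamma>" "\<gamma> < 1" "0 < x"
  shows "C * x powr \<gamma> \<le> x + C * (C powr (1 / (1 - \<gamma>))) powr \<gamma>"
proof (cases "C powr (1 / (1 - \<gamma>)) \<le> x")
  case True
  have "C = (C powr (1 / (1 - \<gamma>))) powr (1 - \<gamma>)"
    using assms by (simp add: powr_powr)
  also have "\<dots> \<le> x powr (1 - \<gamma>)"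
    using True assms by (intro powr_mono2) auto
  finally have "C * x powr \<gamma> \<le> x powr (1 - \<gamma>) * x powr \<gamma>"
    by (intro mult_right_mono) auto
  also have "\<dots> = x" using assms by (simp add: powr_add[symmetric])
  finally show ?thesis using assms by (simp add: add_increasing2)
next
  case False
  then have "C * x powr \<gamma> \<le> C * (C powr (1 / (1 - \<gamma>))) powr \<gamma>"
    using assms by (intro mult_left_mono powr_mono2) auto
  with assms show ?thesis by linarith
qed

lemma abs_exp_diff_le:
  fixes x y M :: real
  assumes "exp x \<le> M" "exp y \<le> M"
  shows "\<bar>exp x - exp y\<bar> \<le> M * \<bar>x - y\<bar>"
proof -
  have *: "\<bar>exp x - exp y\<bar> \<le> exp y * \<bar>x - y\<bar>" if "x \<le> y" for x y :: real
  proof -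
    have "exp y * (1 + (x - y)) \<le> exp y * exp (x - y)"
      by (intro mult_left_mono exp_ge_add_one_self) auto
    also have "\<dots> = exp x" by (simp add: exp_diff)
    finally show ?thesis using that by (simp add: algebra_simps)
  qed
  have "\<bar>exp x - exp y\<bar> \<le> max (exp x) (exp y) * \<bar>x - y\<bar>"
    using *[of x y] *[of y x] by (cases "x \<le> y") (auto simp: max_def abs_minus_commute)
  also have "\<dots> \<le> M * \<bar>x - y\<bar>"
    using assms by (intro mult_right_mono) auto
  finally show ?thesis .
qed

text \<open>
  This turns a bound by \<open>exp (- s) * min (t - s) 1\<close>, linear in the distance of close times and
  constant for distant ones, into a bound by the additive quantity \<open>exp (- s) - exp (- t)\<close>.
\<close>

lemma half_min_le_one_minus_exp:
  fixes u :: real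
  assumes "0 \<le> u"
  shows "min u 1 / 2 \<le> 1 - exp (- u)"
proof -
  have "exp (- u) \<le> 1 / (1 + u)"
    using exp_ge_add_one_self[of u] assms by (simp add: exp_minus inverse_eq_divide frac_le)
  moreover have "min u 1 / 2 \<le> 1 - 1 / (1 + u)"
    using assms mult_left_mono[of u 1 u] by (auto simp: min_def field_simps)
  ultimately show ?thesis by linarith
qed

text \<open>
  Sublinear growth of \<open>b\<close> gives \<open>exp (- 2 b t - 2 t) \<le> H exp (- t)\<close>, half of the drift being spent
  on \<open>b\<close>. For \<open>t \<le> s + 1\<close> the local Lipschitz bound of \<open>exp\<close> yields an increment of order
  \<open>exp (- s) (1 + t)\<^sup>\<gamma> (t - s)\<^bsup>1/p\<^esup>\<close>. The polynomial factor costs another half of the decay, leaving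
  \<open>exp (- s / 2)\<close>, and the \<open>p\<close>-th power with \<open>p \<ge> 2\<close> restores \<open>exp (- s)\<close>.
\<close>

lemma geometric_increments_dominated:
  fixes b :: "real \<Rightarrow> real"
  assumes p: "2 \<le> p" and \<gamma>: "0 \<le> \<gamma>" "\<gamma> < 1" and K: "0 \<le> K"
    and holder: "\<And>s t. 0 \<le> s \<Longrightarrow> s \<le> t \<Longrightarrow> t \<le> s + 1 \<Longrightarrow>
      \<bar>b t - b s\<bar> \<le> K * (1 + t) powr \<gamma> * (t - s) powr (1 / p)"
    and growth: "\<And>n. \<bar>b (real n)\<bar> \<le> K * (1 + real n) powr \<gamma>"
  obtains L where "0 \<le> L"
    and "\<And>s t. 0 \<le> s \<Longrightarrow> s < t \<Longrightarrow>
      \<bar>exp (- 2 * b t - 2 * t) - exp (- 2 * b s - 2 * s)\<bar> powr p \<le> L * (exp (- s) - exp (- t))"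
proof -
  define g where "g t = exp (- 2 * b t - 2 * t)" for t
  define D where "D = 4 * K * ((4 * K) powr (1 / (1 - \<gamma>))) powr \<gamma>"
  define H where "H = exp (D + 1)"
  have b_bound: "\<bar>b t\<bar> \<le> 2 * K * (1 + t) powr \<gamma>" if t: "0 \<le> t" for t
  proof -
    define n where "n = nat \<lfloor>t\<rfloor>"
    have n: "real n \<le> t" "t \<le> real n + 1" using t unfolding n_def by (auto simp: of_nat_nat)
    have "\<bar>b t - b (real n)\<bar> \<le> K * (1 + t) powr \<gamma> * (t - real n) powr (1 / p)"
      using n by (intro holder) auto
    also have "\<dots> \<le> K * (1 + t) powr \<gamma> * 1"
      using n p K by (intro mult_left_mono powr_le1) auto
    finally have 1: "\<bar>b t - b (real n)\<bar> \<le> K * (1 + t) powr \<gamma>" by simp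
    have "K * (1 + real n) powr \<gamma> \<le> K * (1 + t) powr \<gamma>"
      using n K \<gamma> by (intro mult_left_mono powr_mono2) auto
    with growth[of n] 1 show ?thesis by linarith
  qed
  have decay: "g t \<le> H * exp (- t)" if t: "0 \<le> t" for t
  proof -
    have "- 2 * b t \<le> 4 * K * (1 + t) powr \<gamma>" using b_bound[OF t] by linarith
    also have "\<dots> \<le> (1 + t) + D"
      unfolding D_def using K \<gamma> t by (intro sublinear_powr_bound) auto
    finally show ?thesis by (simp add: g_def H_def flip: exp_add)
  qed
  define G where "G = H * (2 * K + 2) * 2 * exp (1/2)"
  have H0: "0 < H" by (simp add: H_def)
  have G0: "0 \<le> G" using H0 K by (simp add: G_def)
  define L where "L = 2 * (G powr p + H powr p)"
  show thesis
  proof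
    show "0 \<le> L" by (simp add: L_def)
    fix s t :: real
    assume st: "0 \<le> s" "s < t"
    have low: "exp (- s) * (min (t - s) 1 / 2) \<le> exp (- s) - exp (- t)"
    proof -
      have "exp (- s) * (min (t - s) 1 / 2) \<le> exp (- s) * (1 - exp (- (t - s)))"
        using st by (intro mult_left_mono half_min_le_one_minus_exp) auto
      also have "\<dots> = exp (- s) - exp (- t)"
        by (simp add: right_diff_distrib flip: exp_add)
      finally show ?thesis .
    qed
    have "H * exp (- t) \<le> H * exp (- s)" using H0 st by simp
    then have gs: "g s \<le> H * exp (- s)" "g t \<le> H * exp (- s)" 
      using decay[of s] decay[of t] st by linarith+
    have g0: "0 \<le> g s" "0 \<le> g t" by (auto simp: g_def)
    have "\<bar>g t - g s\<bar> powr p \<le> 2 * (G powr p + H powr p) * (exp (- s) * (min (t - s) 1 / 2))"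
    proof (cases "t \<le> s + 1")
      case True
      have u: "t - s \<le> (t - s) powr (1 / p)"
        using powr_mono'[of "1 / p" 1 "t - s"] st True p by simp
      have w: "1 \<le> (1 + t) powr \<gamma>" using st \<gamma> by (simp add: ge_one_powr_ge_zero)
      have w2: "(1 + t) powr \<gamma> \<le> 2 * exp (1/2) * exp (s / 2)"
      proof -
        have "(1 + t) powr \<gamma> \<le> (1 + t) powr 1" using st \<gamma> by (intro powr_mono) auto
        also have "\<dots> \<le> 2 * (1 + t / 2)" using st by simp
        also have "\<dots> \<le> 2 * exp (t / 2)" by (intro mult_left_mono exp_ge_add_one_self) auto
        also have "\<dots> \<le> 2 * exp (1/2 + s / 2)" using True by simp
        finally show ?thesis by (simp add: exp_add)
      qed
      have "\<bar>g t - g s\<bar> \<le> H * exp (- s) * \<bar>(- 2 * b t - 2 * t) - (- 2 * b s - 2 * s)\<bar>"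
        unfolding g_def by (rule abs_exp_diff_le) (use gs in \<open>auto simp: g_def\<close>)
      also have "\<bar>(- 2 * b t - 2 * t) - (- 2 * b s - 2 * s)\<bar> \<le> 2 * \<bar>b t - b s\<bar> + 2 * (t - s)"
        using st unfolding abs_if by argo
      also have "\<dots> \<le> 2 * (K * (1 + t) powr \<gamma> * (t - s) powr (1 / p))
          + 2 * ((1 + t) powr \<gamma> * (t - s) powr (1 / p))"
      proof (intro add_mono mult_left_mono)
        show "t - s \<le> (1 + t) powr \<gamma> * (t - s) powr (1 / p)"
          using order_trans[OF u mult_right_mono[OF w, of "(t - s) powr (1 / p)", simplified]] .
      qed (use holder st True in auto)
      also have "\<dots> = (2 * K + 2) * (1 + t) powr \<gamma> * (t - s) powr (1 / p)"
        by (simp add: algebra_simps)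
      also have "\<dots> \<le> (2 * K + 2) * (2 * exp (1/2) * exp (s / 2)) * (t - s) powr (1 / p)"
        using K w2 by (intro mult_right_mono mult_left_mono) auto
      finally have "\<bar>g t - g s\<bar>
          \<le> H * exp (- s) * ((2 * K + 2) * (2 * exp (1/2) * exp (s / 2)) * (t - s) powr (1 / p))"
        using H0 by simp
      also have "\<dots> = G * (exp (- s) * exp (s / 2)) * (t - s) powr (1 / p)"
        by (simp add: G_def mult_ac)
      also have "exp (- s) * exp (s / 2) = exp (- (s / 2))" by (simp flip: exp_add)
      finally have "\<bar>g t - g s\<bar> powr p \<le> (G * exp (- (s / 2)) * (t - s) powr (1 / p)) powr p"
        using p by (intro powr_mono2) auto
      also have "\<dots> = G powr p * exp (- (s / 2)) powr p * (t - s)"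
        using G0 st p by (simp add: powr_mult powr_powr)
      also have "\<dots> \<le> G powr p * exp (- s) * (t - s)"
      proof (intro mult_right_mono mult_left_mono)
        have "2 * s \<le> p * s" using p st by (intro mult_right_mono) auto
        then show "exp (- (s / 2)) powr p \<le> exp (- s)"
          by (simp add: powr_def algebra_simps)
      qed (use st in auto)
      also have "\<dots> \<le> (G powr p + H powr p) * exp (- s) * (t - s)"
        using st by (intro mult_right_mono) auto
      also have "\<dots> = 2 * (G powr p + H powr p) * (exp (- s) * (min (t - s) 1 / 2))"
        using True by (simp add: field_simps)
      finally show ?thesis .
    next
      case False
      have "\<bar>g t - g s\<bar> \<le> H * exp (- s)" using gs g0 by linarith
      then have "\<bar>g t - g s\<bar> powr p \<le> (H * exp (- s)) powr p"
        using p by (intro powr_mono2) auto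
      also have "\<dots> = H powr p * exp (- s) powr p"
        using H0 by (simp add: powr_mult)
      also have "\<dots> \<le> (G powr p + H powr p) * exp (- s)"
      proof (intro mult_mono)
        have "1 * s \<le> p * s" using p st by (intro mult_right_mono) auto
        then show "exp (- s) powr p \<le> exp (- s)" by (simp add: powr_def)
      qed auto
      also have "\<dots> = 2 * (G powr p + H powr p) * (exp (- s) * (min (t - s) 1 / 2))"
        using False by (simp add: field_simps)
      finally show ?thesis .
    qed
    also have "\<dots> \<le> L * (exp (- s) - exp (- t))"
      unfolding L_def by (intro mult_left_mono low) auto
    finally show "\<bar>exp (- 2 * b t - 2 * t) - exp (- 2 * b s - 2 * s)\<bar> powr p
        \<le> L * (exp (- s) - exp (- t))"
      by (simp add: g_def)
  qed
qed

text \<open>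
  The comparison function \<open>\<psi>\<close> coincides with the extension on \<open>(-\<infinity>, 0]\<close> and continues as
  \<open>2 - exp (- t)\<close>. That the path starts at \<open>0\<close> makes the two pieces of the extension meet
  continuously, so an increment across \<open>0\<close> splits into one increment on each side, at the price of
  a factor \<open>2 powr p\<close>.
\<close>

lemma geometric_extension_in_V0:
  fixes b :: "real \<Rightarrow> real"
  assumes p: "2 \<le> p" and \<gamma>: "0 \<le> \<gamma>" "\<gamma> < 1" and K: "0 \<le> K"
    and b0: "b 0 = 0"
    and holder: "\<And>s t. 0 \<le> s \<Longrightarrow> s \<le> t \<Longrightarrow> t \<le> s + 1 \<Longrightarrow>
      \<bar>b t - b s\<bar> \<le> K * (1 + t) powr \<gamma> * (t - s) powr (1 / p)"
    and growth: "\<And>n. \<bar>b (real n)\<bar> \<le> K * (1 + real n) powr \<gamma>"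
  shows "(\<lambda>t. complex_of_real (geometric_extension b t)) \<in> V0 p"
proof -
  obtain L where L: "0 \<le> L" and Lh: "\<And>s t. 0 \<le> s \<Longrightarrow> s < t \<Longrightarrow>
      \<bar>exp (- 2 * b t - 2 * t) - exp (- 2 * b s - 2 * s)\<bar> powr p \<le> L * (exp (- s) - exp (- t))"
    using geometric_increments_dominated[OF p \<gamma> K holder growth] by blast
  define h where "h = geometric_extension b"
  define \<psi> :: "real \<Rightarrow> real" where "\<psi> t = min (max (t + 1) 0) 1 + (1 - exp (- max t 0))" for t
  define A where "A = 2 powr p * (L + 1)"
  have h_neg: "h t = \<psi> t" if "t \<le> 0" for t
    using that b0 by (auto simp: h_def geometric_extension_def \<psi>_def min_def max_def)
  have mono: "\<psi> s \<le> \<psi> t" if "s \<le> t" for s t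
    using that unfolding \<psi>_def by (intro add_mono) auto
  have range: "0 \<le> \<psi> t" "\<psi> t \<le> 2" for t
    unfolding \<psi>_def by (auto simp: min_def max_def)
  have left: "\<bar>h t - h s\<bar> powr p \<le> \<psi> t - \<psi> s" if "s \<le> t" "t \<le> 0" for s t
  proof -
    have 01: "0 \<le> \<psi> t - \<psi> s" "\<psi> t - \<psi> s \<le> 1"
      using mono[of s t] range(1)[of s] that by (auto simp: \<psi>_def min_def max_def)
    have "(\<psi> t - \<psi> s) powr p \<le> (\<psi> t - \<psi> s) powr 1"
      using p 01 by (intro powr_mono') auto
    then show ?thesis using 01 that h_neg by simp
  qed
  have right: "\<bar>h t - h s\<bar> powr p \<le> L * (\<psi> t - \<psi> s)" if "0 \<le> s" "s < t" for s t
    using Lh[of s t] that by (simp add: h_def geometric_extension_def \<psi>_def)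
  have A: "1 \<le> A" "L \<le> A"
  proof -
    have "1 \<le> (2::real) powr p" using p by (simp add: ge_one_powr_ge_zero)
    then have "1 * (L + 1) \<le> A" unfolding A_def using L by (intro mult_right_mono) auto
    then show "1 \<le> A" "L \<le> A" using L by auto
  qed
  have dom: "\<bar>h t - h s\<bar> powr p \<le> A * \<psi> t - A * \<psi> s" if st: "s < t" for s t
  proof -
    have pos: "0 \<le> \<psi> t - \<psi> s" using mono[of s t] st by simp
    consider "t \<le> 0" | "0 \<le> s" | "s < 0" "0 < t" by linarith
    then have "\<bar>h t - h s\<bar> powr p \<le> A * (\<psi> t - \<psi> s)"
    proof cases
      case 1
      then show ?thesis using left[of s t] st mult_right_mono[OF A(1) pos] by simp
    next
      case 2
      then show ?thesis using right[of s t] st mult_right_mono[OF A(2) pos] by simp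
    next
      case 3
      have "\<bar>h t - h s\<bar> \<le> \<bar>h t - h 0\<bar> + \<bar>h 0 - h s\<bar>" by linarith
      also have "\<dots> \<le> 2 * max \<bar>h t - h 0\<bar> \<bar>h 0 - h s\<bar>" unfolding max_def by argo
      finally have "\<bar>h t - h s\<bar> powr p \<le> (2 * max \<bar>h t - h 0\<bar> \<bar>h 0 - h s\<bar>) powr p"
        using p by (intro powr_mono2) auto
      also have "\<dots> = 2 powr p * max \<bar>h t - h 0\<bar> \<bar>h 0 - h s\<bar> powr p"
        by (simp add: powr_mult)
      also have "max \<bar>h t - h 0\<bar> \<bar>h 0 - h s\<bar> powr p
          \<le> \<bar>h t - h 0\<bar> powr p + \<bar>h 0 - h s\<bar> powr p"
        by (auto simp: max_def)
      also have "\<dots> \<le> L * (\<psi> t - \<psi> 0) + (\<psi> 0 - \<psi> s)"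
        using right[of 0 t] left[of s 0] 3 by auto
      also have "\<dots> \<le> (L + 1) * (\<psi> t - \<psi> s)"
      proof -
        have "0 \<le> L * (\<psi> 0 - \<psi> s)" "\<psi> 0 \<le> \<psi> t" using L mono[of s 0] mono[of 0 t] 3 by auto
        then show ?thesis by (simp add: algebra_simps)
      qed
      finally show ?thesis by (simp add: A_def mult_ac)
    qed
    then show ?thesis by (simp add: right_diff_distrib)
  qed
  show ?thesis
    unfolding h_def[symmetric]
  proof (rule in_V0_if_increments_dominated[where \<phi>="\<lambda>t. A * \<psi> t" and a=0 and b="A * 2"])
    show "continuous_on UNIV (\<lambda>t. A * \<psi> t)"
      unfolding \<psi>_def by (intro continuous_intros)
    show "0 \<le> A * \<psi> t" "A * \<psi> t \<le> A * 2" for t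
      using range[of t] A by auto
    show "norm (complex_of_real (h t) - complex_of_real (h s)) powr p \<le> A * \<psi> t - A * \<psi> s"
      if "s < t" for s t
      using dom[OF that] by (simp flip: of_real_diff)
    have "\<forall>\<^sub>F t in at_bot. complex_of_real (h t) = 0"
      using eventually_gt_at_bot[of "- 1"]
      by eventually_elim (auto simp: h_def geometric_extension_def)
    then show "((\<lambda>t. complex_of_real (h t)) \<longlongrightarrow> 0) at_bot"
      by (rule tendsto_eventually)
  qed (use p in simp)
qed

section \<open>Almost sure bounds for Brownian increments\<close>

text \<open>
  Exchanging sum and integral, the random variable \<open>\<Sum>\<^sub>i X\<^sub>i\<^sup>m\<close> has finite expectation, so it is
  almost surely finite, and it dominates each of its terms.
\<close>

lemma AE_bounded_if_moments_summable:
  fixes X :: "'i::countable \<Rightarrow> 'a \<Rightarrow> real"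
  assumes meas: "\<And>i. X i \<in> borel_measurable M"
    and m: "even m" "0 < m"
    and fin: "(\<integral>\<^sup>+ i. \<integral>\<^sup>+ \<omega>. ennreal (X i \<omega> ^ m) \<partial>M \<partial>count_space UNIV) < \<infinity>"
  shows "AE \<omega> in M. \<exists>C\<ge>0. \<forall>i. \<bar>X i \<omega>\<bar> \<le> C"
proof -
  note [measurable] = meas
  let ?S = "\<lambda>\<omega>. \<integral>\<^sup>+ i. ennreal (X i \<omega> ^ m) \<partial>count_space UNIV"
  have "(\<integral>\<^sup>+ \<omega>. ?S \<omega> \<partial>M) < \<infinity>"
    using fin by (subst nn_integral_count_space_nn_integral) auto
  moreover have "?S \<in> borel_measurable M"
    by (intro sigma_finite_measure.borel_measurable_nn_integral
          sigma_finite_measure_count_space_countable) measurable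
  ultimately have "AE \<omega> in M. ?S \<omega> \<noteq> \<infinity>"
    by (intro nn_integral_PInf_AE) auto
  then show ?thesis
  proof eventually_elim
    case (elim \<omega>)
    then obtain c where c: "0 \<le> c" "?S \<omega> = ennreal c"
      by (metis ennreal_cases infinity_ennreal_def)
    \<comment> \<open>Taking the maximum with \<open>1\<close> gives \<open>c \<le> (max c 1) ^ m\<close>, which avoids \<open>m\<close>-th roots.\<close>
    have "\<bar>X i \<omega>\<bar> \<le> max c 1" for i
    proof -
      have "ennreal (X i \<omega> ^ m) \<le> ennreal c"
        using nn_integral_ge_point[of i UNIV "\<lambda>i. ennreal (X i \<omega> ^ m)"] c(2) by simp
      then have "\<bar>X i \<omega>\<bar> ^ m \<le> c" using c m by (simp add: power_even_abs)
      also have "c \<le> max c 1 ^ 1" by simp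
      also have "\<dots> \<le> max c 1 ^ m" using m by (intro power_increasing) auto
      finally show ?thesis using m by (simp add: power_mono_iff)
    qed
    then show ?case by (intro exI[of _ "max c 1"]) auto
  qed
qed

lemma suminf_inverse_squares_finite: "(\<Sum>j. ennreal (1 / real (Suc j) ^ 2)) < \<infinity>"
proof -
  have "summable (\<lambda>j. inverse (real (Suc j) ^ 2))"
    by (rule iffD2[OF summable_Suc_iff[of "\<lambda>n. inverse (real n ^ 2)"]], rule inverse_power_summable) simp
  then have "summable (\<lambda>j. 1 / real (Suc j) ^ 2)"
    by (simp only: inverse_eq_divide)
  then show ?thesis
    unfolding infinity_ennreal_def top.not_eq_extremum[symmetric]
    by (intro ennreal_suminf_neq_top) auto
qed

context brownian_motion
begin

lemma even_moment_scaled_increment: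
  assumes st: "0 \<le> s" "s < t"
  shows "(\<integral>\<^sup>+ \<omega>. ennreal (((B t \<omega> - B s \<omega>) / w) ^ (2 * q)) \<partial>M)
    = ennreal (fact (2 * q) / (2 ^ q * fact q) * (t - s) ^ q / w ^ (2 * q))"
proof -
  let ?\<sigma> = "sqrt (t - s)"
  let ?m = "fact (2 * q) / ((2 / ?\<sigma>\<^sup>2) ^ q * fact q)"
  have "0 < ?\<sigma>" using st by simp
  from has_bochner_integral_divide_zero[OF normal_moment_even[OF this, of 0 q], of "w ^ (2 * q)"]
  have moment: "has_bochner_integral lborel (\<lambda>x. normal_density 0 ?\<sigma> x * (x / w) ^ (2 * q)) (?m / w ^ (2 * q))"
    by (simp add: power_divide)
  have "(\<integral>\<^sup>+ \<omega>. ennreal (((B t \<omega> - B s \<omega>) / w) ^ (2 * q)) \<partial>M)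
      = (\<integral>\<^sup>+ x. ennreal (normal_density 0 ?\<sigma> x) * ennreal ((x / w) ^ (2 * q)) \<partial>lborel)"
    by (rule distributed_nn_integral[OF normal_increments[OF st], symmetric]) simp
  also have "\<dots> = (\<integral>\<^sup>+ x. ennreal (normal_density 0 ?\<sigma> x * (x / w) ^ (2 * q)) \<partial>lborel)"
    by (simp add: ennreal_mult)
  also have "\<dots> = ennreal (?m / w ^ (2 * q))"
    using moment
    by (intro nn_integral_eq_integral[THEN trans]) (auto simp: has_bochner_integral_iff)
  also have "?m = fact (2 * q) / (2 ^ q * fact q) * (t - s) ^ q"
    using st by (simp add: power_divide)
  finally show ?thesis .
qed

text \<open>
  With the weight \<open>r\<^sup>k (1 + j / 2\<^sup>k)\<^bsup>1/q\<^esup>\<close>, the \<open>2q\<close>-th moment of the increment number \<open>j\<close> of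
  generation \<open>k\<close> is a constant times \<open>\<rho>\<^bsup>qk\<^esup> / (1 + j / 2\<^sup>k)\<^sup>2\<close>, where \<open>\<rho> = 1 / (2 r\<^sup>2) < 1\<close>. Since
  \<open>1 + j / 2\<^sup>k \<ge> (j + 1) / 2\<^sup>k\<close>, this is at most \<open>(4 \<rho>\<^sup>q)\<^sup>k / (j + 1)\<^sup>2\<close>, and choosing \<open>q\<close> with
  \<open>\<rho>\<^sup>q \<le> 1/8\<close> makes it summable over both indices. The requirement \<open>q \<ge> 2\<close> keeps the growth
  exponent \<open>1/q\<close> of the weight below \<open>1\<close>.
\<close>

lemma AE_dyadic_increments_bound:
  assumes r: "0 < r" "(1/2) < r\<^sup>2"
  obtains q :: nat where "2 \<le> q"
    and "AE \<omega> in M. \<exists>C\<ge>0. \<forall>k j. \<bar>B (real (Suc j) / 2 ^ k) \<omega> - B (real j / 2 ^ k) \<omega>\<bar>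
      \<le> C * r ^ k * (1 + real j / 2 ^ k) powr (1 / q)"
proof -
  define \<rho> where "\<rho> = 1 / (2 * r\<^sup>2)"
  have \<rho>: "0 < \<rho>" "\<rho> < 1" using r by (auto simp: \<rho>_def)
  obtain q0 where q0: "\<rho> ^ q0 < 1/8" using real_arch_pow_inv[of "1/8" \<rho>] \<rho> by auto
  define q where "q = q0 + 2"
  have q2: "2 \<le> q" by (simp add: q_def)
  have q: "\<rho> ^ q \<le> 1/8"
    using q0 power_decreasing[of q0 q \<rho>] \<rho> unfolding q_def by linarith
  define c :: real where "c = fact (2 * q) / (2 ^ q * fact q)"
  have c: "0 \<le> c" by (simp add: c_def)
  define w where "w k j = r ^ k * (1 + real j / 2 ^ k) powr (1 / q)" for k j :: nat
  have w: "0 < w k j" for k j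
  proof -
    have "0 < 1 + real j / 2 ^ k" by (simp add: add_pos_nonneg)
    with r show ?thesis unfolding w_def by simp
  qed
  define X where "X = (\<lambda>(k, j) \<omega>. (B (real (Suc j) / 2 ^ k) \<omega> - B (real j / 2 ^ k) \<omega>) / w k j)"
  have meas: "X i \<in> borel_measurable M" for i
    unfolding X_def by (cases i) (auto intro!: borel_measurable_divide borel_measurable_diff random_variable_B)
  have moment: "(\<integral>\<^sup>+ \<omega>. ennreal (X (k, j) \<omega> ^ (2 * q)) \<partial>M)
      \<le> ennreal (c * (1/2) ^ k) * ennreal (1 / real (Suc j) ^ 2)" for k j
  proof -
    let ?s = "real j / 2 ^ k" and ?t = "real (Suc j) / 2 ^ k"
    have len: "?t - ?s = (1/2) ^ k" by (simp add: diff_divide_distrib[symmetric] power_one_over)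
    have "w k j ^ (2 * q) = (r ^ k) ^ (2 * q) * ((1 + ?s) powr (1 / q)) ^ (2 * q)"
      by (simp add: w_def power_mult_distrib)
    also have "((1 + ?s) powr (1 / q)) ^ (2 * q) = (1 + ?s) ^ 2"
      using q2 by (subst powr_realpow[symmetric]) (auto simp: powr_powr add_nonneg_eq_0_iff)
    finally have w2: "w k j ^ (2 * q) = (r ^ k) ^ (2 * q) * (1 + ?s) ^ 2" .
    have "?s < ?t" by (simp add: divide_strict_right_mono)
    then have moment_eq: "(\<integral>\<^sup>+ \<omega>. ennreal (X (k, j) \<omega> ^ (2 * q)) \<partial>M)
        = ennreal (c * (?t - ?s) ^ q / w k j ^ (2 * q))"
      using even_moment_scaled_increment[of ?s ?t "w k j" q] by (simp only: X_def c_def split) simp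
    have "c * (?t - ?s) ^ q / w k j ^ (2 * q) = c * (\<rho> ^ q) ^ k / (1 + ?s) ^ 2"
      unfolding len w2 \<rho>_def
      by (simp add: power_divide power_mult_distrib flip: power_mult) (simp add: mult_ac)
    also have "\<dots> \<le> c * (1/8) ^ k / (real (Suc j) / 2 ^ k) ^ 2"
    proof (intro frac_le mult_left_mono power_mono)
      show "real (Suc j) / 2 ^ k \<le> 1 + ?s"
        by (simp add: add_divide_distrib)
    qed (use c q \<rho> in auto)
    also have "\<dots> = (c * (1/2) ^ k) * (1 / real (Suc j) ^ 2)"
    proof -
      have "(8::real) ^ k = 2 ^ k * (2 ^ k * 2 ^ k)" by (simp flip: power_mult_distrib)
      then show ?thesis by (simp add: power_divide power2_eq_square field_simps)
    qed
    finally show ?thesis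
      unfolding moment_eq using c by (subst ennreal_mult[symmetric]) (auto intro: ennreal_leI)
  qed
  have geo: "(\<Sum>k. ennreal (c * (1/2) ^ k)) < \<infinity>"
    unfolding infinity_ennreal_def top.not_eq_extremum[symmetric]
    using c by (intro ennreal_suminf_neq_top summable_mult summable_geometric) auto
  have "(\<integral>\<^sup>+ i. \<integral>\<^sup>+ \<omega>. ennreal (X i \<omega> ^ (2 * q)) \<partial>M \<partial>count_space UNIV)
      = (\<integral>\<^sup>+ k. \<integral>\<^sup>+ j. \<integral>\<^sup>+ \<omega>. ennreal (X (k, j) \<omega> ^ (2 * q)) \<partial>M \<partial>count_space UNIV \<partial>count_space UNIV)"
    by (rule nn_integral_fst_count_space[symmetric])
  also have "\<dots> \<le> (\<integral>\<^sup>+ k. \<integral>\<^sup>+ j. ennreal (c * (1/2) ^ k) * ennreal (1 / real (Suc j) ^ 2)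
      \<partial>count_space UNIV \<partial>count_space UNIV)"
    by (intro nn_integral_mono moment)
  also have "\<dots> = (\<Sum>k. ennreal (c * (1/2) ^ k)) * (\<Sum>j. ennreal (1 / real (Suc j) ^ 2))"
    by (simp only: nn_integral_count_space_nat ennreal_suminf_cmult ennreal_suminf_multc)
  also have "\<dots> < \<infinity>" using suminf_inverse_squares_finite geo by (simp add: ennreal_mult_less_top)
  finally have "AE \<omega> in M. \<exists>C\<ge>0. \<forall>i. \<bar>X i \<omega>\<bar> \<le> C"
    using meas q2 by (intro AE_bounded_if_moments_summable[of _ _ "2 * q"]) auto
  then have "AE \<omega> in M. \<exists>C\<ge>0. \<forall>k j. \<bar>B (real (Suc j) / 2 ^ k) \<omega> - B (real j / 2 ^ k) \<omega>\<bar>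
      \<le> C * r ^ k * (1 + real j / 2 ^ k) powr (1 / q)"
  proof eventually_elim
    case (elim \<omega>)
    then obtain C where C: "0 \<le> C" "\<And>k j. \<bar>X (k, j) \<omega>\<bar> \<le> C" by blast
    have "\<bar>B (real (Suc j) / 2 ^ k) \<omega> - B (real j / 2 ^ k) \<omega>\<bar> \<le> C * w k j" for k j
      using C(2)[of k j] w[of k j] by (simp add: X_def abs_divide pos_divide_le_eq)
    with C(1) show ?case by (auto simp: w_def mult.assoc)
  qed
  with q2 that show thesis by blast
qed

text \<open>
  The eighth moment of \<open>B n\<close> is of order \<open>n\<^sup>4\<close>, and dividing by \<open>(n\<^bsup>3/4\<^esup>)\<^sup>8 = n\<^sup>6\<close> leaves the
  summable \<open>n\<^bsup>-2\<^esup>\<close>. Any exponent in \<open>(1/2, 1)\<close> could be reached with a higher moment; below \<open>1\<close>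
  it is enough for the drift to dominate. The family starts at \<open>n = 1\<close>, since the weight vanishes
  at \<open>0\<close>.
\<close>

lemma AE_growth_at_integers:
  "AE \<omega> in M. \<exists>C\<ge>0. \<forall>n. \<bar>B (real n) \<omega>\<bar> \<le> C * (1 + real n) powr (3/4)"
proof -
  define c :: real where "c = fact (2 * 4) / (2 ^ 4 * fact 4)"
  have c: "0 \<le> c" by (simp add: c_def)
  define X where "X n \<omega> = (B (real (Suc n)) \<omega> - B 0 \<omega>) / real (Suc n) powr (3/4)" for n \<omega>
  have meas: "X n \<in> borel_measurable M" for n
    unfolding X_def by (auto intro!: borel_measurable_divide borel_measurable_diff random_variable_B)
  have moment: "(\<integral>\<^sup>+ \<omega>. ennreal (X n \<omega> ^ (2 * 4)) \<partial>M) = ennreal (c / real (Suc n) ^ 2)" for n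
  proof -
    have pw: "(real (Suc n) powr (3/4)) ^ (2 * 4) = real (Suc n) ^ 6"
      by (simp add: powr_powr flip: powr_numeral)
    have "(\<integral>\<^sup>+ \<omega>. ennreal (X n \<omega> ^ (2 * 4)) \<partial>M)
        = ennreal (c * (real (Suc n) - 0) ^ 4 / (real (Suc n) powr (3/4)) ^ (2 * 4))"
      unfolding X_def c_def by (rule even_moment_scaled_increment) auto
    also have "c * (real (Suc n) - 0) ^ 4 / (real (Suc n) powr (3/4)) ^ (2 * 4) = c / real (Suc n) ^ 2"
      unfolding pw by (simp add: divide_simps flip: power_add del: of_nat_Suc)
    finally show ?thesis .
  qed
  have "(\<Sum>n. ennreal (c / real (Suc n) ^ 2)) = (\<Sum>n. ennreal c * ennreal (1 / real (Suc n) ^ 2))"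
    using c by (simp flip: ennreal_mult)
  also have "\<dots> = ennreal c * (\<Sum>n. ennreal (1 / real (Suc n) ^ 2))"
    by (rule ennreal_suminf_cmult)
  also have "\<dots> < \<infinity>"
    using suminf_inverse_squares_finite by (simp add: ennreal_mult_less_top)
  finally have "(\<Sum>n. ennreal (c / real (Suc n) ^ 2)) < \<infinity>" .
  then have "(\<integral>\<^sup>+ n. \<integral>\<^sup>+ \<omega>. ennreal (X n \<omega> ^ (2 * 4)) \<partial>M \<partial>count_space UNIV) < \<infinity>"
    by (simp only: moment nn_integral_count_space_nat)
  then have "AE \<omega> in M. \<exists>C\<ge>0. \<forall>n. \<bar>X n \<omega>\<bar> \<le> C"
    using meas by (intro AE_bounded_if_moments_summable[of _ _ "2 * 4"]) auto
  with start_zero show ?thesis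
  proof eventually_elim
    case (elim \<omega>)
    then obtain C where C: "0 \<le> C" "\<And>n. \<bar>X n \<omega>\<bar> \<le> C" by blast
    have "\<bar>B (real n) \<omega>\<bar> \<le> C * (1 + real n) powr (3/4)" for n
    proof (cases n)
      case 0
      then show ?thesis using elim(1) C by simp
    next
      case (Suc k)
      have "\<bar>B (real n) \<omega>\<bar> \<le> C * real n powr (3/4)"
        using C(2)[of k] elim(1) unfolding Suc
        by (simp add: X_def abs_divide pos_divide_le_eq del: of_nat_Suc)
      also have "\<dots> \<le> C * (1 + real n) powr (3/4)"
        using C by (intro mult_left_mono powr_mono2) auto
      finally show ?thesis .
    qed
    with C(1) show ?case by blast
  qed
qed

end

theorem proposition7p3:
  fixes M :: "'a measure" and \<beta> :: "real \<Rightarrow> 'a \<Rightarrow> real" and p :: real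
  assumes "brownian_motion M \<beta>"
    and "2 < p"
  shows "AE \<omega> in M. (\<lambda>t. complex_of_real (geometric_extension (\<lambda>s. \<beta> s \<omega>) t)) \<in> V0 p"
proof -
  interpret brownian_motion M \<beta> by fact
  \<comment> \<open>With this ratio \<open>r ^ k\<close> is the \<open>1/p\<close>-th power of the mesh \<open>2 powr - k\<close>,
    and \<open>1/2 < r\<^sup>2\<close> amounts to \<open>p > 2\<close>.\<close>
  define r :: real where "r = 2 powr - (1 / p)"
  have "r\<^sup>2 = 2 powr - (2 / p)"
    by (simp add: r_def power2_eq_square flip: powr_add)
  moreover have "(2::real) powr - 1 < 2 powr - (2 / p)"
    using assms(2) by (intro powr_less_mono) auto
  ultimately have r: "0 < r" "1/2 < r\<^sup>2" by (auto simp: r_def powr_minus)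
  obtain q :: nat where q: "2 \<le> q"
    and dyadic: "AE \<omega> in M. \<exists>C\<ge>0. \<forall>k j. \<bar>\<beta> (real (Suc j) / 2 ^ k) \<omega> - \<beta> (real j / 2 ^ k) \<omega>\<bar>
      \<le> C * r ^ k * (1 + real j / 2 ^ k) powr (1 / q)"
    using AE_dyadic_increments_bound[OF r] by blast
  from dyadic AE_growth_at_integers start_zero continuous_paths show ?thesis
  proof eventually_elim
    case (elim \<omega>)
    from elim(1) obtain C where C: "0 \<le> C"
      "\<And>k j. \<bar>\<beta> (real (Suc j) / 2 ^ k) \<omega> - \<beta> (real j / 2 ^ k) \<omega>\<bar>
      \<le> C * r ^ k * (1 + real j / 2 ^ k) powr (1 / q)" by blast
    from elim(2) obtain C' where C': "0 \<le> C'"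
      "\<And>n. \<bar>\<beta> (real n) \<omega>\<bar> \<le> C' * (1 + real n) powr (3/4)" by blast
    \<comment> \<open>Since \<open>1/q \<le> 1/2\<close>, both bounds hold with the common growth exponent \<open>3/4\<close>.\<close>
    have dyadic': "\<bar>\<beta> (real (Suc j) / 2 ^ k) \<omega> - \<beta> (real j / 2 ^ k) \<omega>\<bar>
      \<le> C * (2 powr - (1 / p)) ^ k * (1 + real j / 2 ^ k) powr (3/4)" for k j
    proof -
      have "1 / real q \<le> 1 / 2" using q by (intro frac_le) auto
      then have "C * r ^ k * (1 + real j / 2 ^ k) powr (1 / q)
          \<le> C * r ^ k * (1 + real j / 2 ^ k) powr (3/4)"
        using C r by (intro mult_left_mono powr_mono) auto
      with C(2)[of j k] show ?thesis by (simp add: r_def)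
    qed
    obtain K where K: "0 \<le> K" "\<And>s t. 0 \<le> s \<Longrightarrow> s \<le> t \<Longrightarrow> t \<le> s + 1 \<Longrightarrow>
      \<bar>\<beta> t \<omega> - \<beta> s \<omega>\<bar> \<le> K * (1 + t) powr (3/4) * (t - s) powr (1 / p)"
      using holder_from_dyadic_increments[OF elim(4) _ C(1) _ dyadic'] assms(2) by auto
    show ?case
    proof (rule geometric_extension_in_V0[where K="max K C'" and \<gamma>="3/4"])
      fix s t :: real
      assume "0 \<le> s" "s \<le> t" "t \<le> s + 1"
      then have "\<bar>\<beta> t \<omega> - \<beta> s \<omega>\<bar> \<le> K * ((1 + t) powr (3/4) * (t - s) powr (1 / p))"
        using K(2) by (simp add: mult.assoc)
      also have "\<dots> \<le> max K C' * ((1 + t) powr (3/4) * (t - s) powr (1 / p))"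
        by (intro mult_right_mono) auto
      finally show "\<bar>\<beta> t \<omega> - \<beta> s \<omega>\<bar> \<le> max K C' * (1 + t) powr (3/4) * (t - s) powr (1 / p)"
        by (simp add: mult.assoc)
    next
      fix n
      have "C' * (1 + real n) powr (3/4) \<le> max K C' * (1 + real n) powr (3/4)"
        by (intro mult_right_mono) auto
      with C'(2)[of n] show "\<bar>\<beta> (real n) \<omega>\<bar> \<le> max K C' * (1 + real n) powr (3/4)" by linarith
    qed (use assms(2) elim(3) K(1) in auto)
  qed
qed

end
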